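(* For every $n \in \mathbb{N}$, there is a set of $n$ points in general position in the plane $\mathbb{R}^2$ that has at most $19683^n$ peeling sequences.
   Context: $\mathbb{N}$ denotes the set of natural numbers. A set of points in the plane is in general position if no three of its points are collinear. Let $P$ be a finite set of $n$ (labeled) points in the plane in general position. Consider the process that removes the points of $P$ one by one until no point remains, where in each step exactly one extreme point, i.e. one vertex of the convex hull of the set of currently remaining points, is removed. A peeling sequence of $P$ is a permutation $(p_1,\dots,p_n)$ of the points of $P$ obtained by listing the points in the order of their removal in such a process; i.e. for each $i$, $p_i$ is an extreme point of $\{p_i, p_{i+1},\dots,p_n\}$ (equivalently, $p_i \notin \mathrm{conv}\{p_{i+1},\dots,p_n\}$). *)

theory Defs
  imports "HOL-Analysis.Analysis" "HOL-Combinatorics.Multiset_Permutations"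
begin

definition general_position :: "(real ^ 2) set \<Rightarrow> bool" where
  "general_position P \<longleftrightarrow>
     (\<forall>a\<in>P. \<forall>b\<in>P. \<forall>c\<in>P. a \<noteq> b \<and> a \<noteq> c \<and> b \<noteq> c \<longrightarrow> \<not> collinear {a, b, c})"

(* set (drop i ps) is the set of points that remain when the i-th point (counting from 0)
   is about to be removed. *)
definition peeling_sequences :: "(real ^ 2) set \<Rightarrow> (real ^ 2) list set" where
  "peeling_sequences P =
     {ps \<in> permutations_of_set P.
        \<forall>i<length ps. (ps ! i) extreme_point_of (convex hull (set (drop i ps)))}"

lemma finite_peeling_sequences: "finite (peeling_sequences P)"
  by (simp add: peeling_sequences_def)

end

theory Submission
  imports Defs
begin

text \<open>Place three flattened affine copies of smaller configurations along three rays from the origin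
whose directions positively span the plane. As long as all three copies are nonempty, any point other
than the outermost remaining one of its copy lies in a triangle formed by that outermost point and a
point of each of the two other copies. Hence the copy that is exhausted first is removed in a forced
order, and a peeling sequence is determined by the word of copies it visits together with the peeling
sequences it induces on the other two copies. For sizes \<open>m, m, n - 2 m\<close> with \<open>m = n div 3\<close> this gives
\<open>f n \<le> 3 ^ (n + 1) * 19683 ^ (n - m)\<close>, and \<open>n + 1 \<le> 9 * m\<close> closes the induction since
\<open>19683 = 3 ^ 9\<close>.\<close>

section \<open>Peeling sequences as lists: restriction and affine images\<close>

text \<open>Recursion on the removal order replaces the indices of \<open>peeling_sequences\<close>
  and makes list induction available. Distinctness comes for free: a repeated point lies in the hull
  of the rest.\<close>

primrec peels :: "'a::real_vector list \<Rightarrow> bool" where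
  "peels [] \<longleftrightarrow> True"
| "peels (p # ps) \<longleftrightarrow> p \<notin> convex hull set ps \<and> peels ps"

lemma peels_imp_distinct: "peels ps \<Longrightarrow> distinct ps"
  by (induction ps) (auto intro: hull_inc)

text \<open>Discarding points only shrinks the hull of what remains. Hence a peeling sequence
  induces one on every colour class.\<close>

lemma peels_filter: "peels ps \<Longrightarrow> peels (filter Q ps)"
proof (induction ps)
  case (Cons p ps)
  have "convex hull set (filter Q ps) \<subseteq> convex hull set ps"
    by (rule hull_mono) auto
  with Cons show ?case by auto
qed simp

lemma extreme_point_of_hull_insert_iff:
  fixes p :: "'a::euclidean_space"
  assumes "finite S" "p \<notin> S"
  shows "p extreme_point_of (convex hull insert p S) \<longleftrightarrow> p \<notin> convex hull S"
  using assms extreme_point_of_convex_hull[of p S] extreme_point_of_convex_hull_insert[of S p]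
  by (auto simp: hull_redundant)

lemma peels_iff_extreme:
  fixes ps :: "'a::euclidean_space list"
  assumes "distinct ps"
  shows "peels ps \<longleftrightarrow>
    (\<forall>i<length ps. (ps ! i) extreme_point_of (convex hull set (drop i ps)))"
  using assms
  by (induction ps) (auto simp: All_less_Suc2 extreme_point_of_hull_insert_iff)

lemma peeling_sequences_eq: "peeling_sequences P = {ps. set ps = P \<and> peels ps}"
  unfolding peeling_sequences_def permutations_of_set_def
  using peels_iff_extreme peels_imp_distinct by blast

lemma filter_peeling_sequences:
  assumes "ps \<in> peeling_sequences P"
  shows "filter Q ps \<in> peeling_sequences {p \<in> P. Q p}"
  using assms by (auto simp: peeling_sequences_eq peels_filter)

text \<open>Affine maps send hulls into hulls, so a point that is not extreme among the remaining
  ones stays so in the image.\<close>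

lemma peels_map_affine:
  fixes f :: "'a::real_vector \<Rightarrow> 'b::real_vector"
  assumes "linear f" "peels (map (\<lambda>p. a + f p) ps)"
  shows "peels ps"
  using assms(2)
proof (induction ps)
  case (Cons p ps)
  have "a + f p \<in> convex hull ((\<lambda>p. a + f p) ` set ps)" if "p \<in> convex hull set ps"
  proof -
    have "(\<lambda>p. a + f p) ` set ps = (+) a ` f ` set ps"
      by (simp add: image_image)
    then show ?thesis
      using in_convex_hull_linear_image[OF assms(1) that]
      by (metis convex_hull_translation image_eqI)
  qed
  with Cons show ?case by auto
qed simp

lemma card_peeling_sequences_affine_image_le:
  assumes "linear f" "inj_on (\<lambda>p. a + f p) P"
  shows "card (peeling_sequences ((\<lambda>p. a + f p) ` P)) \<le> card (peeling_sequences P)"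
proof -
  let ?g = "\<lambda>p. a + f p"
  have "peeling_sequences (?g ` P) \<subseteq> map ?g ` peeling_sequences P"
  proof
    fix qs assume "qs \<in> peeling_sequences (?g ` P)"
    then have qs: "set qs = ?g ` P" "peels qs"
      by (auto simp: peeling_sequences_eq)
    define ps where "ps = map (the_inv_into P ?g) qs"
    have "map ?g ps = map id qs"
      unfolding ps_def map_map using qs(1) f_the_inv_into_f[OF assms(2)]
      by (intro map_cong) (auto simp del: add_left_cancel)
    moreover have "set ps = P"
      using qs(1) the_inv_into_onto[OF assms(2)] by (simp add: ps_def)
    ultimately show "qs \<in> map ?g ` peeling_sequences P"
      using peels_map_affine[OF assms(1), of a ps] qs(2)
      by (auto simp: peeling_sequences_eq)
  qed
  then show ?thesis
    using card_mono card_image_le finite_peeling_sequences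
    by (metis (no_types, lifting) finite_imageI order_trans)
qed

section \<open>Counting peeling sequences of a three-coloured set\<close>

text \<open>A list is a shuffle of its colour subsequences, and the word of colours tells how to
  interleave them.\<close>

lemma map_eq_filter_eq_imp_eq:
  assumes "map c xs = map c ys"
    and "\<And>j. filter (\<lambda>x. c x = j) xs = filter (\<lambda>x. c x = j) ys"
  shows "xs = ys"
  using map_eq_imp_length_eq[OF assms(1)] assms
proof (induction xs ys rule: list_induct2)
  case (Cons x xs y ys)
  have "x = y"
    using Cons.prems(1) Cons.prems(2)[of "c x"] by simp
  have "filter (\<lambda>x. c x = j) xs = filter (\<lambda>x. c x = j) ys" for j
    using Cons.prems(2)[of j] \<open>x = y\<close> by (auto split: if_splits)
  with Cons \<open>x = y\<close> show ?case by simp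
qed simp

text \<open>A smaller value of \<open>h\<close> means further out.\<close>

lemma exists_sorted_colour_class:
  fixes c :: "'a::real_vector \<Rightarrow> nat" and h :: "'a \<Rightarrow> real"
  assumes hull: "\<And>p q r s. \<lbrakk>p \<in> P; q \<in> P; r \<in> P; s \<in> P; c q = c p; h q < h p;
      {c p, c r, c s} = {..<3}\<rbrakk> \<Longrightarrow> p \<in> convex hull {q, r, s}"
    and "c ` P \<subseteq> {..<3}" "peels ps" "set ps \<subseteq> P"
  shows "\<exists>j<3. sorted (map h (filter (\<lambda>p. c p = j) ps))"
  using assms(3,4)
proof (induction ps)
  case Nil
  show ?case by (intro exI[of _ 0]) simp
next
  case (Cons p ps)
  then obtain j where j: "j < 3" "sorted (map h (filter (\<lambda>p. c p = j) ps))"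
    by auto
  show ?case
  \<comment> \<open>Prepending \<open>p\<close> keeps class \<open>j\<close> sorted unless
    \<open>p\<close> has colour \<open>j\<close> and a point of that colour further out is still
    present.\<close>
  proof (cases "c p = j \<and> (\<exists>q\<in>set ps. c q = j \<and> h q < h p)")
    case False
    with j show ?thesis by (intro exI[of _ j]) (auto simp: not_less)
  next
    case True
    then obtain q where q: "q \<in> set ps" "c q = j" "h q < h p" by blast
    define k where "k = (if j = 0 then 1 else 0::nat)"
    define l where "l = (if j = 2 then 1 else 2::nat)"
    have jkl: "{j, k, l} = {..<3}" "k < 3" "l < 3" "j \<noteq> k" "j \<noteq> l"
      using j(1) by (auto simp: k_def l_def)
    \<comment> \<open>If both other colours were still present, \<open>p\<close> would lie in a
      triangle of remaining points. So one of them is exhausted, its subsequence is empty and thus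
      trivially sorted, and it replaces \<open>j\<close> as the witness.\<close>
    have "\<exists>i\<in>{k, l}. \<forall>r\<in>set ps. c r \<noteq> i"
    proof (rule ccontr)
      assume "\<not> ?thesis"
      then obtain r s where rs: "r \<in> set ps" "s \<in> set ps" "c r = k" "c s = l"
        by auto
      then have "p \<in> convex hull {q, r, s}"
        using hull[of p q r s] q True jkl Cons.prems by auto
      also have "\<dots> \<subseteq> convex hull set ps"
        using rs q by (intro hull_mono) auto
      finally show False using Cons.prems by simp
    qed
    then obtain i where "i \<in> {k, l}" "\<forall>r\<in>set ps. c r \<noteq> i" by blast
    with True jkl have "filter (\<lambda>p. c p = i) (p # ps) = []" "i < 3"
      by (auto simp: filter_empty_conv)
    then show ?thesis by (intro exI[of _ i]) simp
  qed
qed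

text \<open>Since \<open>h\<close> is injective on class \<open>j\<close>, sortedness leaves just
  one order for that class. The colour word and the other two subsequences therefore determine the
  whole sequence.\<close>

lemma card_peeling_sequences_sorted_le:
  fixes c :: "real ^ 2 \<Rightarrow> nat" and h :: "real ^ 2 \<Rightarrow> real"
  assumes "c ` P \<subseteq> {..<3}" "{j, k, l} = {..<3}"
    and inj: "inj_on h {p \<in> P. c p = j}"
  shows "card {ps \<in> peeling_sequences P. sorted (map h (filter (\<lambda>p. c p = j) ps))}
    \<le> 3 ^ card P * (card (peeling_sequences {p \<in> P. c p = k}) *
                      card (peeling_sequences {p \<in> P. c p = l}))"
    (is "card ?E \<le> _ * (card ?K * card ?L)")
proof -
  let ?W = "{w. set w \<subseteq> {..<3::nat} \<and> length w = card P}"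
  define code where
    "code ps = (map c ps, filter (\<lambda>p. c p = k) ps, filter (\<lambda>p. c p = l) ps)" for ps
  have "inj_on code ?E"
  proof (rule inj_onI)
    fix xs ys assume xs: "xs \<in> ?E" and ys: "ys \<in> ?E" and eq: "code xs = code ys"
    have [simp]: "set xs = P" "set ys = P" "distinct xs" "distinct ys"
      using xs ys by (auto simp: peeling_sequences_eq peels_imp_distinct)
    have "filter (\<lambda>p. c p = j) xs = filter (\<lambda>p. c p = j) ys"
      using xs ys inj by (intro map_sorted_distinct_set_unique[of h]) (auto simp: distinct_map)
    moreover have "filter (\<lambda>p. c p = i) xs = filter (\<lambda>p. c p = i) ys" if "i \<notin> {j, k, l}" for i
    proof -
      have "c p \<noteq> i" if "p \<in> P" for p
        using assms(1,2) \<open>i \<notin> {j, k, l}\<close> that by auto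
      then show ?thesis by (simp cong: filter_cong)
    qed
    ultimately have "filter (\<lambda>p. c p = i) xs = filter (\<lambda>p. c p = i) ys" for i
      using eq by (cases "i \<in> {j, k, l}") (auto simp: code_def)
    moreover have "map c xs = map c ys"
      using eq by (simp add: code_def)
    ultimately show "xs = ys"
      by (metis map_eq_filter_eq_imp_eq)
  qed
  moreover have "code ` ?E \<subseteq> ?W \<times> ?K \<times> ?L"
  proof (rule image_subsetI)
    fix ps assume ps: "ps \<in> ?E"
    then have "set ps = P" "length ps = card P"
      using distinct_card peels_imp_distinct by (fastforce simp: peeling_sequences_eq)+
    then show "code ps \<in> ?W \<times> ?K \<times> ?L"
      using ps assms(1) filter_peeling_sequences by (auto simp: code_def)
  qed
  moreover have fin: "finite ?W"
    using finite_lists_length_eq[of "{..<3::nat}"] by simp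
  ultimately have "card ?E \<le> card (?W \<times> ?K \<times> ?L)"
    by (intro card_inj_on_le finite_cartesian_product finite_peeling_sequences)
  also have "\<dots> = 3 ^ card P * (card ?K * card ?L)"
    using card_lists_length_eq[of "{..<3::nat}"] by (simp add: card_cartesian_product)
  finally show ?thesis .
qed

text \<open>Union bound over which class is sorted; the three choices account for the
  \<open>Suc\<close> in the exponent.\<close>

lemma card_peeling_sequences_three_classes_le:
  fixes c :: "real ^ 2 \<Rightarrow> nat" and h :: "real ^ 2 \<Rightarrow> real"
  assumes hull: "\<And>p q r s. \<lbrakk>p \<in> P; q \<in> P; r \<in> P; s \<in> P; c q = c p; h q < h p;
      {c p, c r, c s} = {..<3}\<rbrakk> \<Longrightarrow> p \<in> convex hull {q, r, s}"
    and colours: "c ` P \<subseteq> {..<3}"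
    and inj: "\<And>j. j < 3 \<Longrightarrow> inj_on h {p \<in> P. c p = j}"
    and M: "\<And>k l. \<lbrakk>k < 3; l < 3; k \<noteq> l\<rbrakk> \<Longrightarrow>
      card (peeling_sequences {p \<in> P. c p = k}) *
      card (peeling_sequences {p \<in> P. c p = l}) \<le> M"
  shows "card (peeling_sequences P) \<le> 3 ^ Suc (card P) * M"
proof -
  define E where
    "E j = {ps \<in> peeling_sequences P. sorted (map h (filter (\<lambda>p. c p = j) ps))}" for j
  have "card (E j) \<le> 3 ^ card P * M" if "j < 3" for j
  proof -
    define k where "k = (if j = 0 then 1 else 0::nat)"
    define l where "l = (if j = 2 then 1 else 2::nat)"
    have jkl: "{j, k, l} = {..<3}" "k < 3" "l < 3" "k \<noteq> l"
      using that by (auto simp: k_def l_def)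
    have "card (E j) \<le> 3 ^ card P * (card (peeling_sequences {p \<in> P. c p = k}) *
        card (peeling_sequences {p \<in> P. c p = l}))"
      unfolding E_def by (intro card_peeling_sequences_sorted_le colours jkl inj that)
    also have "\<dots> \<le> 3 ^ card P * M"
      using M jkl by (intro mult_left_mono) auto
    finally show ?thesis .
  qed
  then have "(\<Sum>j<3. card (E j)) \<le> (\<Sum>j<3::nat. 3 ^ card P * M)"
    by (intro sum_mono) auto
  moreover have "peeling_sequences P \<subseteq> (\<Union>j<3. E j)"
  proof
    fix ps assume ps: "ps \<in> peeling_sequences P"
    then have "peels ps" "set ps \<subseteq> P"
      by (auto simp: peeling_sequences_eq)
    then obtain j where "j < 3" "sorted (map h (filter (\<lambda>p. c p = j) ps))"
      using exists_sorted_colour_class[of P c h ps, OF hull colours] by blast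
    with ps show "ps \<in> (\<Union>j<3. E j)"
      by (auto simp: E_def)
  qed
  then have "card (peeling_sequences P) \<le> card (\<Union>j<3. E j)"
    by (intro card_mono) (auto simp: E_def finite_peeling_sequences)
  moreover have "card (\<Union>j<3. E j) \<le> (\<Sum>j<3. card (E j))"
    by (rule card_UN_le) simp
  ultimately show ?thesis by simp
qed

section \<open>Signed areas, triangles and generic linear functionals\<close>

text \<open>Twice the signed area of the triangle \<open>p q r\<close>.\<close>

definition orient :: "real ^ 2 \<Rightarrow> real ^ 2 \<Rightarrow> real ^ 2 \<Rightarrow> real" where
  "orient p q r = (q $ 1 - p $ 1) * (r $ 2 - p $ 2) - (q $ 2 - p $ 2) * (r $ 1 - p $ 1)"

lemma collinear_iff_orient: "collinear {p, q, r} \<longleftrightarrow> orient p q r = 0"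
proof
  assume "collinear {p, q, r}"
  then consider "p = r" | u where "q = u *\<^sub>R p + (1 - u) *\<^sub>R r"
    unfolding collinear_3_expand by blast
  then show "orient p q r = 0"
  proof cases
    case (2 u)
    have "q $ 1 = u * p $ 1 + (1 - u) * r $ 1" "q $ 2 = u * p $ 2 + (1 - u) * r $ 2"
      by (simp_all add: 2)
    then show ?thesis
      unfolding orient_def by algebra
  qed (simp add: orient_def)
next
  assume "orient p q r = 0"
  then have eq: "(q $ 1 - r $ 1) * (p $ 2 - r $ 2) = (q $ 2 - r $ 2) * (p $ 1 - r $ 1)"
    unfolding orient_def by algebra
  show "collinear {p, q, r}"
  proof (cases "p = r")
    case False
    then have "p $ 1 - r $ 1 \<noteq> 0 \<or> p $ 2 - r $ 2 \<noteq> 0"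
      by (auto simp: vec_eq_iff forall_2)
    then obtain u where u: "u * (p $ 1 - r $ 1) = q $ 1 - r $ 1" "u * (p $ 2 - r $ 2) = q $ 2 - r $ 2"
    proof
      assume "p $ 1 - r $ 1 \<noteq> 0"
      with eq show ?thesis
        by (intro that[of "(q $ 1 - r $ 1) / (p $ 1 - r $ 1)"]) simp_all
    next
      assume "p $ 2 - r $ 2 \<noteq> 0"
      with eq show ?thesis
        by (intro that[of "(q $ 2 - r $ 2) / (p $ 2 - r $ 2)"]) (simp_all flip: eq)
    qed
    have "q $ 1 = u * p $ 1 + (1 - u) * r $ 1" "q $ 2 = u * p $ 2 + (1 - u) * r $ 2"
      using u by algebra+
    then have "q = u *\<^sub>R p + (1 - u) *\<^sub>R r"
      by (simp add: vec_eq_iff forall_2)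
    then show ?thesis unfolding collinear_3_expand by blast
  qed (simp add: insert_commute)
qed

text \<open>The barycentric coordinates of \<open>p\<close> are quotients of signed areas (Cramer's
  rule). Stating positivity through products avoids a case split on the sign of
  \<open>orient q r s\<close>.\<close>

lemma in_triangle_if_orient:
  assumes "0 < orient p r s * orient q r s" "0 < orient q p s * orient q r s"
    "0 < orient q r p * orient q r s"
  shows "p \<in> convex hull {q, r, s}"
proof -
  define D where "D = orient q r s"
  have "D \<noteq> 0"
    using assms by (auto simp: D_def)
  have sum: "orient p r s + orient q p s + orient q r p = D"
    by (simp add: D_def orient_def algebra_simps)
  have "0 \<le> orient p r s / D" "0 \<le> orient q p s / D" "0 \<le> orient q r p / D"
    using assms by (auto simp: D_def zero_less_mult_iff intro: divide_nonneg_pos divide_nonpos_neg)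
  moreover have "orient p r s / D + orient q p s / D + orient q r p / D = 1"
    using sum \<open>D \<noteq> 0\<close> by (simp add: field_simps)
  moreover have "D *\<^sub>R p = orient p r s *\<^sub>R q + orient q p s *\<^sub>R r + orient q r p *\<^sub>R s"
    by (simp add: D_def vec_eq_iff forall_2 orient_def algebra_simps)
  then have "(1 / D) *\<^sub>R D *\<^sub>R p =
      (1 / D) *\<^sub>R (orient p r s *\<^sub>R q + orient q p s *\<^sub>R r + orient q r p *\<^sub>R s)"
    by simp
  then have "p = (orient p r s / D) *\<^sub>R q + (orient q p s / D) *\<^sub>R r + (orient q r p / D) *\<^sub>R s"
    using \<open>D \<noteq> 0\<close> by (simp add: scaleR_add_right)
  ultimately show ?thesis
    unfolding convex_hull_3 by blast
qed

text \<open>The values serve as distances from the origin along a ray. Coefficient 1 at the first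
  coordinate makes \<open>(x, y) \<mapsto> (x + t * y + s, y)\<close> area-preserving.\<close>

lemma exists_separating_functional:
  fixes P :: "(real ^ 2) set"
  assumes "finite P"
  shows "\<exists>t s. (\<forall>p\<in>P. 0 < p $ 1 + t * p $ 2 + s) \<and> inj_on (\<lambda>p. p $ 1 + t * p $ 2 + s) P"
proof -
  \<comment> \<open>The set \<open>?B\<close> contains every \<open>t\<close> for which two points
    with different second coordinates get equal values.\<close>
  have "finite ((\<lambda>(p, q). (q $ 1 - p $ 1) / (p $ 2 - q $ 2)) ` (P \<times> P))" (is "finite ?B")
    using assms by simp
  then obtain t where t: "t \<notin> ?B"
    using ex_new_if_finite infinite_UNIV_char_0 by blast
  define s where "s = 1 + (\<Sum>p\<in>P. \<bar>p $ 1 + t * p $ 2\<bar>)"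
  have "0 < p $ 1 + t * p $ 2 + s" if "p \<in> P" for p
    using member_le_sum[of p P "\<lambda>p. \<bar>p $ 1 + t * p $ 2\<bar>"] that assms by (simp add: s_def)
  moreover have "inj_on (\<lambda>p. p $ 1 + t * p $ 2 + s) P"
  proof (rule inj_onI)
    fix p q assume pq: "p \<in> P" "q \<in> P" "p $ 1 + t * p $ 2 + s = q $ 1 + t * q $ 2 + s"
    have "p $ 2 = q $ 2"
    proof (rule ccontr)
      assume "p $ 2 \<noteq> q $ 2"
      with pq(3) have "t = (q $ 1 - p $ 1) / (p $ 2 - q $ 2)"
        by (simp add: field_simps)
      with t pq show False by force
    qed
    with pq(3) show "p = q" by (simp add: vec_eq_iff forall_2)
  qed
  ultimately show ?thesis by blast
qed

section \<open>Points on and near three rays from the origin\<close>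

text \<open>The three ray directions sum to zero, and each is paired with a transversal direction such that
the two have determinant 1. The points will have a transversal coordinate proportional to a small
\<open>e\<close>; all strict conditions on them are checked at \<open>e = 0\<close>, where the points lie on the rays.\<close>

definition ray_point :: "nat \<Rightarrow> real \<Rightarrow> real \<Rightarrow> real ^ 2" where
  "ray_point j x y =
     x *\<^sub>R (if j = 0 then vector [1, 0] else if j = 1 then vector [0, 1] else vector [-1, -1]) +
     y *\<^sub>R (if j = 0 then vector [0, 1] else if j = 1 then vector [-1, 0] else vector [1, 0])"

lemma ray_point_nth [simp]:
  "ray_point j x y $ 1 = (if j = 0 then x else if j = 1 then - y else y - x)"
  "ray_point j x y $ 2 = (if j = 0 then y else if j = 1 then x else - x)"
  by (auto simp: ray_point_def)

text \<open>Orientation is polynomial in the coordinates, so strict sign conditions at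
  \<open>e = 0\<close> persist for all small positive \<open>e\<close>.\<close>

lemma tendsto_orient_ray_points:
  "((\<lambda>e. orient (ray_point i x (e * x')) (ray_point j y (e * y')) (ray_point k z (e * z')))
    \<longlongrightarrow> orient (ray_point i x 0) (ray_point j y 0) (ray_point k z 0)) (at_right 0)"
proof -
  have *: "((\<lambda>e. ray_point j x (e * y)) \<longlongrightarrow> ray_point j x 0) (at_right 0)" for j x y
    unfolding ray_point_def by (auto intro!: tendsto_eq_intros)
  show ?thesis
    unfolding orient_def by (intro tendsto_intros *)
qed

text \<open>Here the limit at \<open>e = 0\<close> vanishes and says nothing, so the exact value is
  needed. It is a plain multiple of \<open>e\<close> because the two directions of a ray have
  determinant 1.\<close>

lemma orient_same_ray:
  "orient (ray_point j x (e * x')) (ray_point j y (e * y')) (ray_point j z (e * z')) =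
   e * ((y - x) * (z' - x') - (y' - x') * (z - x))"
  by (simp add: orient_def algebra_simps)

text \<open>Up to sign the value is a sum of positive products for three different rays, and
  (difference on the shared ray) times (distance on the other ray) for two.\<close>

lemma orient_rays_nonzero:
  assumes "i < 3" "j < 3" "k < 3" "0 < x" "0 < y" "0 < z" "\<not> (i = j \<and> j = k)"
    and "i = j \<Longrightarrow> x \<noteq> y" "i = k \<Longrightarrow> x \<noteq> z" "j = k \<Longrightarrow> y \<noteq> z"
  shows "orient (ray_point i x 0) (ray_point j y 0) (ray_point k z 0) \<noteq> 0"
proof -
  have pos: "0 < x * y" "0 < y * z" "0 < x * z"
    using assms by auto
  have neq: "i = j \<longrightarrow> x * z \<noteq> y * z" "i = k \<longrightarrow> x * y \<noteq> y * z" "j = k \<longrightarrow> x * y \<noteq> x * z"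
    using assms by auto
  have "i \<in> {0, 1, 2}" "j \<in> {0, 1, 2}" "k \<in> {0, 1, 2}"
    using assms by auto
  then show ?thesis
    using pos neq assms(7)
    by (elim insertE emptyE) (simp_all add: orient_def algebra_simps)
qed

text \<open>The sign \<open>\<sigma>\<close> tells whether \<open>i, j, k\<close> is in cyclic
  order. It is common to all three values, so it cancels in the products that
  \<open>in_triangle_if_orient\<close> asks for.\<close>

lemma orient_rays_eq:
  fixes i j k :: nat
  assumes "{i, j, k} = {..<3}" and "\<sigma> = (if j = Suc i mod 3 then 1 else -1)"
  shows
    "orient (ray_point i x 0) (ray_point j y 0) (ray_point k z 0) = \<sigma> * (x * y + y * z + z * x)"
    "orient (ray_point i y 0) (ray_point i x 0) (ray_point k z 0) = \<sigma> * ((y - x) * z)"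
    "orient (ray_point i y 0) (ray_point j z 0) (ray_point i x 0) = \<sigma> * ((y - x) * z)"
proof -
  have "distinct [i, j, k]"
    using assms(1) card_distinct[of "[i, j, k]"] by simp
  moreover have "i < 3" "j < 3" "k < 3"
    unfolding lessThan_iff[symmetric] assms(1)[symmetric] by simp_all
  then have "i \<in> {0, 1, 2}" "j \<in> {0, 1, 2}" "k \<in> {0, 1, 2}"
    by auto
  ultimately have "(i, j, k) \<in> {(0, 1, 2), (1, 2, 0), (2, 0, 1), (0, 2, 1), (1, 0, 2), (2, 1, 0)}"
    by (elim insertE emptyE) simp_all
  then show
    "orient (ray_point i x 0) (ray_point j y 0) (ray_point k z 0) = \<sigma> * (x * y + y * z + z * x)"
    "orient (ray_point i y 0) (ray_point i x 0) (ray_point k z 0) = \<sigma> * ((y - x) * z)"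
    "orient (ray_point i y 0) (ray_point j z 0) (ray_point i x 0) = \<sigma> * ((y - x) * z)"
    unfolding assms(2) by (elim insertE emptyE; simp add: orient_def algebra_simps)+
qed

text \<open>At \<open>e = 0\<close> the inner point is strictly inside the triangle, and strict
  containment survives a small perturbation.\<close>

lemma eventually_inner_ray_point_in_triangle:
  assumes "{i, j, k} = {..<3}" "0 < x" "x < y" "0 < z" "0 < w"
  shows "\<forall>\<^sub>F e in at_right 0. ray_point i x (e * x') \<in>
    convex hull {ray_point i y (e * y'), ray_point j z (e * z'), ray_point k w (e * w')}"
proof -
  let ?D = "orient (ray_point i y 0) (ray_point j z 0) (ray_point k w 0)"
  define \<sigma> :: real where "\<sigma> = (if j = Suc i mod 3 then 1 else -1)"
  note eq = orient_rays_eq[OF assms(1) \<sigma>_def]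
  have pos: "0 < x * z + z * w + w * x" "0 < y * z + z * w + w * y" "0 < (y - x) * w" "0 < (y - x) * z"
    using assms(2-) by (auto intro!: add_pos_pos)
  have *: "0 < (\<sigma> * a) * (\<sigma> * b)" if "0 < a" "0 < b" for a b
    using that by (auto simp: \<sigma>_def)
  have
    "0 < orient (ray_point i x 0) (ray_point j z 0) (ray_point k w 0) * ?D"
    "0 < orient (ray_point i y 0) (ray_point i x 0) (ray_point k w 0) * ?D"
    "0 < orient (ray_point i y 0) (ray_point j z 0) (ray_point i x 0) * ?D"
    unfolding eq by (intro * pos)+
  note this[THEN order_tendstoD(1)[OF tendsto_mult[OF tendsto_orient_ray_points tendsto_orient_ray_points]]]
  from this[of x' z' w' y' z' w'] this(2)[of y' x' w' y' z' w'] this(3)[of y' z' x' y' z' w']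
  show ?thesis
    by eventually_elim (rule in_triangle_if_orient)
qed

section \<open>Gluing three configurations along the rays\<close>

text \<open>General position and the triangle property amount to finitely many conditions, each
  valid for all small \<open>e > 0\<close>, so a single \<open>e\<close> satisfies them all.\<close>

lemma amalgamate_on_rays:
  fixes P :: "nat \<Rightarrow> (real ^ 2) set"
  assumes fin: "\<And>j. j < 3 \<Longrightarrow> finite (P j)"
    and ne: "\<And>j. j < 3 \<Longrightarrow> P j \<noteq> {}"
    and gp: "\<And>j. j < 3 \<Longrightarrow> general_position (P j)"
    and M: "\<And>k l. \<lbrakk>k < 3; l < 3; k \<noteq> l\<rbrakk> \<Longrightarrow>
      card (peeling_sequences (P k)) * card (peeling_sequences (P l)) \<le> M"
  shows "\<exists>Q. finite Q \<and> card Q = (\<Sum>j<3. card (P j)) \<and> general_position Q \<and>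
    card (peeling_sequences Q) \<le> 3 ^ Suc (card Q) * M"
proof -
  have "\<forall>j\<in>{..<3}. \<exists>t s. (\<forall>p\<in>P j. 0 < p $ 1 + t * p $ 2 + s) \<and>
      inj_on (\<lambda>p. p $ 1 + t * p $ 2 + s) (P j)"
    using exists_separating_functional fin by simp
  then obtain t s where ts: "\<And>j. j < 3 \<Longrightarrow> (\<forall>p\<in>P j. 0 < p $ 1 + t j * p $ 2 + s j) \<and>
      inj_on (\<lambda>p. p $ 1 + t j * p $ 2 + s j) (P j)"
    unfolding bchoice_iff by auto
  define h where "h j p = p $ 1 + t j * p $ 2 + s j" for j and p :: "real ^ 2"
  have h_pos: "0 < h j p" if "j < 3" "p \<in> P j" for j p
    using ts that by (auto simp: h_def)
  have h_inj: "inj_on (h j) (P j)" if "j < 3" for j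
    using ts that by (auto simp: h_def[abs_def])
  \<comment> \<open>The tag keeps the copies apart, since the sets \<open>P j\<close> may
    overlap.\<close>
  define I where "I = (SIGMA j:{..<3}. P j)"
  have fin_I: "finite I"
    using fin by (auto simp: I_def)
  define g where "g e = (\<lambda>(j, p). ray_point j (h j p) (e * p $ 2))" for e

  have "\<forall>\<^sub>F e in at_right 0. orient (g e a) (g e b) (g e c) \<noteq> 0"
    if "a \<in> I" "b \<in> I" "c \<in> I" "a \<noteq> b" "a \<noteq> c" "b \<noteq> c" for a b c
  proof -
    obtain i p j q k r where eq: "a = (i, p)" "b = (j, q)" "c = (k, r)"
      by (metis prod.exhaust)
    with that have in_P: "i < 3" "p \<in> P i" "j < 3" "q \<in> P j" "k < 3" "r \<in> P k"
      by (auto simp: I_def)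
    show ?thesis
    proof (cases "i = j \<and> j = k")
      case True
      then have "orient p q r \<noteq> 0"
        using gp[of i] that in_P by (auto simp: general_position_def collinear_iff_orient eq)
      moreover have "orient (g e a) (g e b) (g e c) = e * orient p q r" for e
        using True by (simp add: g_def eq orient_same_ray h_def orient_def algebra_simps)
      ultimately show ?thesis
        by (simp add: eventually_at_filter)
    next
      case False
      have "orient (ray_point i (h i p) 0) (ray_point j (h j q) 0) (ray_point k (h k r) 0) \<noteq> 0"
        using in_P False that h_pos
        by (intro orient_rays_nonzero) (auto simp: eq dest: inj_onD[OF h_inj])
      then show ?thesis
        unfolding g_def eq prod.case
        by (rule tendsto_imp_eventually_ne[OF tendsto_orient_ray_points])
    qed
  qed
  then have "\<forall>\<^sub>F e in at_right 0. \<forall>a\<in>I. \<forall>b\<in>I. \<forall>c\<in>I. a \<noteq> b \<longrightarrow> a \<noteq> c \<longrightarrow> b \<noteq> c \<longrightarrow>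
      orient (g e a) (g e b) (g e c) \<noteq> 0"
    using fin_I by (simp add: eventually_ball_finite_distrib)
  moreover
  have "\<forall>\<^sub>F e in at_right 0. g e a \<in> convex hull {g e b, g e c, g e d}"
    if "a \<in> I" "b \<in> I" "c \<in> I" "d \<in> I" "fst b = fst a" "h (fst a) (snd a) < h (fst b) (snd b)"
      "{fst a, fst c, fst d} = {..<3}" for a b c d
    using that h_pos eventually_inner_ray_point_in_triangle[OF that(7)]
    by (auto simp: I_def g_def)
  then have "\<forall>\<^sub>F e in at_right 0. \<forall>a\<in>I. \<forall>b\<in>I. \<forall>c\<in>I. \<forall>d\<in>I. fst b = fst a \<longrightarrow>
      h (fst a) (snd a) < h (fst b) (snd b) \<longrightarrow> {fst a, fst c, fst d} = {..<3} \<longrightarrow>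
      g e a \<in> convex hull {g e b, g e c, g e d}"
    using fin_I by (simp add: eventually_ball_finite_distrib)
  ultimately have "\<forall>\<^sub>F e in at_right 0.
      (\<forall>a\<in>I. \<forall>b\<in>I. \<forall>c\<in>I. a \<noteq> b \<longrightarrow> a \<noteq> c \<longrightarrow> b \<noteq> c \<longrightarrow>
        orient (g e a) (g e b) (g e c) \<noteq> 0) \<and>
      (\<forall>a\<in>I. \<forall>b\<in>I. \<forall>c\<in>I. \<forall>d\<in>I. fst b = fst a \<longrightarrow>
        h (fst a) (snd a) < h (fst b) (snd b) \<longrightarrow> {fst a, fst c, fst d} = {..<3} \<longrightarrow>
        g e a \<in> convex hull {g e b, g e c, g e d})"
    by (rule eventually_conj)
  from eventually_happens'[OF trivial_limit_at_right_real this] obtain e where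
    e: "\<forall>a\<in>I. \<forall>b\<in>I. \<forall>c\<in>I. a \<noteq> b \<longrightarrow> a \<noteq> c \<longrightarrow> b \<noteq> c \<longrightarrow>
        orient (g e a) (g e b) (g e c) \<noteq> 0"
      "\<forall>a\<in>I. \<forall>b\<in>I. \<forall>c\<in>I. \<forall>d\<in>I. fst b = fst a \<longrightarrow>
        h (fst a) (snd a) < h (fst b) (snd b) \<longrightarrow> {fst a, fst c, fst d} = {..<3} \<longrightarrow>
        g e a \<in> convex hull {g e b, g e c, g e d}"
    by (elim exE conjE)
  note gen = e(1)[rule_format] and hull = e(2)[rule_format]

  have inj: "inj_on (g e) I"
  proof (rule inj_onI, rule ccontr)
    fix a b assume ab: "a \<in> I" "b \<in> I" "g e a = g e b" "a \<noteq> b"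
    \<comment> \<open>A point on a ray used by neither \<open>a\<close> nor \<open>b\<close> gives a
      triple that would be degenerate if \<open>g e a = g e b\<close>.\<close>
    obtain j where j: "j < 3" "j \<noteq> fst a" "j \<noteq> fst b"
    proof -
      have "\<not> {..<3} \<subseteq> {fst a, fst b}"
        using card_mono[of "{fst a, fst b}" "{..<3}"] by (auto simp: card_insert_if split: if_splits)
      then show ?thesis using that by auto
    qed
    with ne obtain p where "(j, p) \<in> I"
      by (auto simp: I_def)
    moreover have "a \<noteq> (j, p)" "b \<noteq> (j, p)"
      using j by auto
    ultimately have "orient (g e a) (g e b) (g e (j, p)) \<noteq> 0"
      using gen ab by blast
    with ab(3) show False by (simp add: orient_def)
  qed

  define Q where "Q = g e ` I"
  define f where "f = the_inv_into I (g e)"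
  have f: "f (g e a) = a" if "a \<in> I" for a
    using inj that by (simp add: f_def the_inv_into_f_f)
  have card_Q: "card Q = (\<Sum>j<3. card (P j))"
    using inj fin by (simp add: Q_def card_image I_def)
  have "general_position Q"
    unfolding general_position_def collinear_iff_orient Q_def ball_simps using gen by blast
  moreover have "card (peeling_sequences Q) \<le> 3 ^ Suc (card Q) * M"
  \<comment> \<open>The minus sign is needed because \<open>h\<close> grows outwards, whereas the
    counting lemma takes smaller values as further out.\<close>
  proof (rule card_peeling_sequences_three_classes_le[where c = "\<lambda>q. fst (f q)" and
        h = "\<lambda>q. - h (fst (f q)) (snd (f q))"])
    have class_eq: "{q \<in> Q. fst (f q) = j} = (\<lambda>p. g e (j, p)) ` P j" if "j < 3" for j
      using that f by (auto simp: Q_def I_def)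
    show "(\<lambda>q. fst (f q)) ` Q \<subseteq> {..<3}"
      using f by (auto simp: Q_def I_def)
    show "inj_on (\<lambda>q. - h (fst (f q)) (snd (f q))) {q \<in> Q. fst (f q) = j}" if "j < 3" for j
      unfolding class_eq[OF that] using that f
      by (auto simp: I_def intro!: inj_onI dest: inj_onD[OF h_inj])
    show "q \<in> convex hull {r, v, w}"
      if "q \<in> Q" "r \<in> Q" "v \<in> Q" "w \<in> Q" "fst (f r) = fst (f q)"
        "- h (fst (f r)) (snd (f r)) < - h (fst (f q)) (snd (f q))"
        "{fst (f q), fst (f v), fst (f w)} = {..<3}" for q r v w
    proof -
      obtain a b c d where "q = g e a" "r = g e b" "v = g e c" "w = g e d"
        "a \<in> I" "b \<in> I" "c \<in> I" "d \<in> I"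
        using \<open>q \<in> Q\<close> \<open>r \<in> Q\<close> \<open>v \<in> Q\<close> \<open>w \<in> Q\<close> unfolding Q_def by blast
      with that(5-) show ?thesis
        using hull[of a b c d] by (simp add: f)
    qed
    have class_le: "card (peeling_sequences {q \<in> Q. fst (f q) = j}) \<le> card (peeling_sequences (P j))"
      if "j < 3" for j
    proof -
      \<comment> \<open>\<open>A\<close> is the linear part of the map placing \<open>P j\<close> on
        its ray; the shift \<open>s j\<close> becomes a translation along the ray.\<close>
      define A where "A p = ray_point j (p $ 1 + t j * p $ 2) (e * p $ 2)" for p :: "real ^ 2"
      have "linear A"
        by (rule linearI) (simp_all add: A_def vec_eq_iff forall_2 algebra_simps)
      moreover have g_eq: "(\<lambda>p. g e (j, p)) = (\<lambda>p. ray_point j (s j) 0 + A p)"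
        by (simp add: g_def h_def A_def vec_eq_iff forall_2 fun_eq_iff)
      moreover have "inj_on (\<lambda>p. g e (j, p)) (P j)"
        using inj that by (auto simp: I_def intro!: inj_onI dest: inj_onD)
      ultimately show ?thesis
        unfolding class_eq[OF that] g_eq by (intro card_peeling_sequences_affine_image_le)
    qed
    show "card (peeling_sequences {q \<in> Q. fst (f q) = k}) *
        card (peeling_sequences {q \<in> Q. fst (f q) = l}) \<le> M"
      if "k < 3" "l < 3" "k \<noteq> l" for k l
      using mult_le_mono[OF class_le class_le] M that order_trans by blast
  qed
  ultimately show ?thesis
    using card_Q fin_I by (intro exI[of _ Q]) (simp add: Q_def)
qed

section \<open>Small sets and the induction on the number of points\<close>

lemma general_position_if_card_less_3:
  assumes "finite P" "card P < 3"
  shows "general_position P"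
  unfolding general_position_def
proof (intro ballI impI)
  fix a b c assume *: "a \<in> P" "b \<in> P" "c \<in> P" "a \<noteq> b \<and> a \<noteq> c \<and> b \<noteq> c"
  then have "card {a, b, c} \<le> card P"
    using assms(1) by (intro card_mono) auto
  with * assms(2) show "\<not> collinear {a, b, c}" by simp
qed

theorem corollary1:
  fixes n :: nat
  shows "\<exists>P :: (real ^ 2) set. finite P \<and> card P = n \<and> general_position P \<and>
           card (peeling_sequences P) \<le> 19683 ^ n"
proof (induction n rule: less_induct)
  case (less n)
  show ?case
  proof (cases "n < 3")
    case True
    obtain P :: "(real ^ 2) set" where P: "finite P" "card P = n"
      using infinite_arbitrarily_large[of "UNIV :: (real ^ 2) set" n] infinite_UNIV_char_0
      by (metis infinite_UNIV_vec)
    have "card (peeling_sequences P) \<le> card (permutations_of_set P)"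
      by (intro card_mono) (auto simp: peeling_sequences_def)
    also have "\<dots> = fact n"
      using P by simp
    also have "\<dots> \<le> 19683 ^ n"
    proof -
      have "n = 0 \<or> n = 1 \<or> n = 2"
        using True by auto
      then show ?thesis by (auto simp: fact_2)
    qed
    finally show ?thesis
      using P True general_position_if_card_less_3 by blast
  next
    case False
    define m where "m = n div 3"
    define size where "size j = (if j = 2 then n - 2 * m else m)" for j :: nat
    have m: "1 \<le> m" "3 * m \<le> n" "n \<le> 3 * m + 2"
      using False by (auto simp: m_def)
    have size: "0 < size j" "size j < n" for j
      using m by (auto simp: size_def)
    obtain P :: "nat \<Rightarrow> (real ^ 2) set" where P: "\<And>j. finite (P j)" "\<And>j. card (P j) = size j"
      "\<And>j. general_position (P j)" "\<And>j. card (peeling_sequences (P j)) \<le> 19683 ^ size j"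
      using less.IH[OF size(2)] by metis
    have "card (peeling_sequences (P k)) * card (peeling_sequences (P l)) \<le> 19683 ^ (n - m)"
      if "k < 3" "l < 3" "k \<noteq> l" for k l
    proof -
      have "card (peeling_sequences (P k)) * card (peeling_sequences (P l)) \<le>
          19683 ^ (size k + size l)"
        using P(4) by (simp add: power_add mult_le_mono)
      \<comment> \<open>The class left out has at least \<open>m\<close> points, so the other two
        have at most \<open>n - m\<close> together.\<close>
      also have "\<dots> \<le> 19683 ^ (n - m)"
        using m that by (intro power_increasing) (auto simp: size_def)
      finally show ?thesis .
    qed
    moreover have "P j \<noteq> {}" for j
      using P(2)[of j] size(1)[of j] by auto
    ultimately obtain Q where Q: "finite Q" "card Q = (\<Sum>j<3. card (P j))" "general_position Q"
      "card (peeling_sequences Q) \<le> 3 ^ Suc (card Q) * 19683 ^ (n - m)"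
      using amalgamate_on_rays[of P "19683 ^ (n - m)"] P by blast
    have "card Q = n"
      using Q(2) P(2) m by (simp add: size_def eval_nat_numeral)
    \<comment> \<open>The saved factor \<open>19683 ^ m\<close> pays for the colour words:
      \<open>n + 1 \<le> 3 * m + 3 \<le> 9 * m\<close> as \<open>1 \<le> m\<close>.\<close>
    have "(3::nat) ^ Suc n \<le> 3 ^ (9 * m)"
      using m by (intro power_increasing) auto
    also have "\<dots> = 19683 ^ m"
      by (simp add: power_mult)
    finally have "3 ^ Suc n * 19683 ^ (n - m) \<le> (19683::nat) ^ m * 19683 ^ (n - m)"
      by (rule mult_right_mono) simp
    also have "\<dots> = 19683 ^ n"
      using m by (simp flip: power_add)
    finally have "card (peeling_sequences Q) \<le> 19683 ^ n"
      using Q(4) unfolding \<open>card Q = n\<close> by (rule order_trans[rotated])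
    with Q(1,3) \<open>card Q = n\<close> show ?thesis by blast
  qed
qed

end
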